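(* Let $X$ be an Archimedean vector lattice. If $X$ is uniformly complete, then every ideal of finite codimension in $X$ is uniformly closed.
   Context: Vector lattices are over $\mathbb R$. An ideal is a linear subspace $J$ such that $|x|\le|y|$ and $y\in J$ imply $x\in J$. For $e\in X_+$, $I_e$ is the principal ideal generated by $e$, with the norm $\|x\|_e=\inf\{\lambda>0 : |x|\le\lambda e\}$. $X$ is uniformly complete if $(I_e,\|\cdot\|_e)$ is complete for every $e\in X_+$. A net $(x_\alpha)$ in $X$ converges (relatively) uniformly to $x\in X$ if there is $e\in X_+$ with $\|x_\alpha-x\|_e\to 0$ (in particular, $x_\alpha-x\in I_e$ for all sufficiently large $\alpha$). A subset $A\subseteq X$ is uniformly closed if it is closed with respect to uniform convergence; equivalently, $A\cap I_e$ is closed in $(I_e,\|\cdot\|_e)$ for every $e\in X_+$. A subspace $F$ of $X$ has codimension $n$ if $\dim X/F=n$. *)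

theory Defs
  imports
    Complex_Main
    "HOL-Library.Lattice_Algebras"
    "HOL-Library.Set_Algebras"
    "Jordan_Normal_Form.VS_Connect"
begin

section \<open>Vector lattices\<close>

class vector_lattice = ordered_real_vector + lattice_ab_group_add_abs

class archimedean_vector_lattice = vector_lattice +
  assumes archimedean: "(\<And>n::nat. real n *\<^sub>R x \<le> y) \<Longrightarrow> x \<le> 0"

instance real :: archimedean_vector_lattice
proof
  fix x y :: real
  assume le: "\<And>n::nat. real n *\<^sub>R x \<le> y"
  show "x \<le> 0"
  proof (rule ccontr)
    assume "\<not> x \<le> 0"
    then obtain n :: nat where "y < real n * x"
      using reals_Archimedean3[of x] by auto
    with le[of n] show False by simp
  qed
qed

definition order_ideal :: "'a::vector_lattice set \<Rightarrow> bool" where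
  "order_ideal J \<longleftrightarrow>
     Real_Vector_Spaces.subspace J \<and> (\<forall>x y. \<bar>x\<bar> \<le> \<bar>y\<bar> \<and> y \<in> J \<longrightarrow> x \<in> J)"

definition principal_ideal :: "'a::vector_lattice \<Rightarrow> 'a set" where
  "principal_ideal e = order_ideal hull {e}"

text \<open>Meaningful only for \<open>x \<in> principal_ideal e\<close> with \<open>0 \<le> e\<close>: for other \<open>x\<close> the
  infimum is taken over the empty set and its value is arbitrary.\<close>

definition order_norm :: "'a::vector_lattice \<Rightarrow> 'a \<Rightarrow> real" where
  "order_norm e x = Inf {c. 0 < c \<and> \<bar>x\<bar> \<le> c *\<^sub>R e}"

lemma principal_ideal_iff:
  fixes e :: "'a::vector_lattice"
  assumes e: "0 \<le> e"
  shows "x \<in> principal_ideal e \<longleftrightarrow> (\<exists>c>0. \<bar>x\<bar> \<le> c *\<^sub>R e)"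
proof
  let ?I = "{x. \<exists>c>0. \<bar>x\<bar> \<le> c *\<^sub>R e}"
  have "order_ideal ?I"
    unfolding order_ideal_def
  proof (intro conjI allI impI)
    show "Real_Vector_Spaces.subspace ?I"
      unfolding Real_Vector_Spaces.subspace_def
    proof (intro conjI ballI allI)
      show "0 \<in> ?I"
        using e by (auto intro!: exI[of _ 1])
    next
      fix x y assume "x \<in> ?I" "y \<in> ?I"
      then obtain c d where cd: "c > 0" "\<bar>x\<bar> \<le> c *\<^sub>R e" "d > 0" "\<bar>y\<bar> \<le> d *\<^sub>R e"
        by blast
      have "\<bar>x + y\<bar> \<le> \<bar>x\<bar> + \<bar>y\<bar>" by (rule abs_triangle_ineq)
      also have "\<dots> \<le> c *\<^sub>R e + d *\<^sub>R e" using cd by (intro add_mono)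
      finally have "\<bar>x + y\<bar> \<le> (c + d) *\<^sub>R e" by (simp only: scaleR_add_left)
      with cd show "x + y \<in> ?I" by (intro CollectI exI[of _ "c + d"]) simp
    next
      fix r :: real and x assume "x \<in> ?I"
      then obtain c where c: "c > 0" "\<bar>x\<bar> \<le> c *\<^sub>R e" by blast
      have pm: "x \<le> \<bar>x\<bar>" "- x \<le> \<bar>x\<bar>"
        by (auto simp: abs_ge_self abs_ge_minus_self)
      have "\<bar>r *\<^sub>R x\<bar> \<le> \<bar>r\<bar> *\<^sub>R \<bar>x\<bar>"
      proof (cases "0 \<le> r")
        case True
        then show ?thesis
          using scaleR_left_mono[OF pm(1), of r] scaleR_left_mono[OF pm(2), of r]
          by (auto intro!: abs_leI)
      next
        case False
        then show ?thesis
          using scaleR_left_mono[OF pm(1), of "- r"] scaleR_left_mono[OF pm(2), of "- r"]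
          by (auto intro!: abs_leI)
      qed
      also have "\<dots> \<le> \<bar>r\<bar> *\<^sub>R (c *\<^sub>R e)"
        using c by (intro scaleR_left_mono) auto
      also have "\<dots> \<le> (\<bar>r\<bar> * c + 1) *\<^sub>R e"
        using e by (simp add: scaleR_add_left)
      finally show "r *\<^sub>R x \<in> ?I"
        using c by (auto intro!: exI[of _ "\<bar>r\<bar> * c + 1"] add_nonneg_pos)
    qed
  next
    fix x y assume "\<bar>x\<bar> \<le> \<bar>y\<bar> \<and> y \<in> ?I"
    then show "x \<in> ?I" by (auto intro: order_trans)
  qed
  moreover have "e \<in> ?I"
    using e by (auto intro!: exI[of _ 1])
  ultimately have "principal_ideal e \<subseteq> ?I"
    unfolding principal_ideal_def by (intro hull_minimal) auto
  then show "x \<in> principal_ideal e \<Longrightarrow> \<exists>c>0. \<bar>x\<bar> \<le> c *\<^sub>R e" by auto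
next
  assume "\<exists>c>0. \<bar>x\<bar> \<le> c *\<^sub>R e"
  then obtain c where c: "c > 0" "\<bar>x\<bar> \<le> c *\<^sub>R e" by auto
  then have le: "\<bar>x\<bar> \<le> \<bar>c *\<^sub>R e\<bar>" by (meson abs_ge_self order_trans)
  show "x \<in> principal_ideal e"
    unfolding principal_ideal_def hull_def
  proof (safe)
    fix J assume J: "order_ideal J" "{e} \<subseteq> J"
    then have "c *\<^sub>R e \<in> J"
      by (auto simp: order_ideal_def Real_Vector_Spaces.subspace_def)
    with J le show "x \<in> J" unfolding order_ideal_def by blast
  qed
qed


section \<open>Uniform completeness, convergence and closedness\<close>

definition uniformly_complete :: "'a::vector_lattice itself \<Rightarrow> bool" where
  "uniformly_complete _ \<longleftrightarrow>
     (\<forall>e::'a. 0 \<le> e \<longrightarrow>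
       (\<forall>s::nat \<Rightarrow> 'a.
          (\<forall>n. s n \<in> principal_ideal e) \<and>
          (\<forall>\<epsilon>>0. \<exists>N. \<forall>m\<ge>N. \<forall>n\<ge>N. order_norm e (s m - s n) < \<epsilon>) \<longrightarrow>
          (\<exists>x\<in>principal_ideal e. (\<lambda>n. order_norm e (s n - x)) \<longlonglongrightarrow> 0)))"

definition uniformly_tendsto ::
    "('i \<Rightarrow> 'a::vector_lattice) \<Rightarrow> 'a \<Rightarrow> 'i filter \<Rightarrow> bool" where
  "uniformly_tendsto f x F \<longleftrightarrow>
     (\<exists>e\<ge>0. (\<forall>\<^sub>F i in F. f i - x \<in> principal_ideal e) \<and>
            ((\<lambda>i. order_norm e (f i - x)) \<longlongrightarrow> 0) F)"

text \<open>Nets are rendered by filters. A quantifier over the index type of a net is not available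
  inside a definition, but filters on the space itself suffice: a net converges to \<open>x\<close> iff
  its image filter does, and every proper filter containing \<open>A\<close> is the image filter of a net
  in \<open>A\<close>.\<close>

definition uniformly_closed :: "'a::vector_lattice set \<Rightarrow> bool" where
  "uniformly_closed A \<longleftrightarrow>
     (\<forall>F x. F \<noteq> bot \<and> (\<forall>\<^sub>F y in F. y \<in> A) \<and> uniformly_tendsto (\<lambda>y. y) x F \<longrightarrow> x \<in> A)"

lemma uniformly_closedD:
  assumes "uniformly_closed A" "F \<noteq> bot" "\<forall>\<^sub>F i in F. f i \<in> A" "uniformly_tendsto f x F"
  shows "x \<in> A"
proof -
  have "uniformly_tendsto (\<lambda>y. y) x (filtermap f F)"
    using assms(4) unfolding uniformly_tendsto_def
    by (simp add: eventually_filtermap filterlim_filtermap)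
  moreover have "filtermap f F \<noteq> bot" "\<forall>\<^sub>F y in filtermap f F. y \<in> A"
    using assms by (auto simp: filtermap_bot_iff eventually_filtermap)
  ultimately show ?thesis
    using assms(1) unfolding uniformly_closed_def by blast
qed


section \<open>Quotient spaces and codimension\<close>

text \<open>The scalar multiple of a coset is enlarged by \<open>F\<close> so that \<open>0\<close> times a coset is \<open>F\<close>
  and not \<open>{0}\<close>. The fields \<open>mult\<close> and \<open>one\<close> of the record play no role for modules.\<close>

definition quotient_space :: "'a::real_vector set \<Rightarrow> (real, 'a set) module" where
  "quotient_space F =
     \<lparr>carrier = range (\<lambda>x. x +o F), mult = undefined, one = undefined,
      zero = F, add = (+), smult = (\<lambda>r C. (\<lambda>x. r *\<^sub>R x) ` C + F)\<rparr>"

lemma coset_add: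
  assumes F: "Real_Vector_Spaces.subspace F"
  shows "(x +o F) + (y +o F) = (x + y) +o F"
proof -
  have "F + F = F"
  proof (intro equalityI subsetI)
    fix z assume "z \<in> F + F"
    then show "z \<in> F"
      using F by (auto simp: Real_Vector_Spaces.subspace_def elim!: set_plus_elim)
  next
    fix z assume "z \<in> F"
    moreover have "0 \<in> F" using F by (simp add: Real_Vector_Spaces.subspace_def)
    ultimately have "0 + z \<in> F + F" by (intro set_plus_intro)
    then show "z \<in> F + F" by simp
  qed
  then show ?thesis
    unfolding set_plus_rearrange by (rule arg_cong)
qed

lemma coset_scaleR:
  assumes F: "Real_Vector_Spaces.subspace F"
  shows "(\<lambda>x. r *\<^sub>R x) ` (x +o F) + F = (r *\<^sub>R x) +o F"
proof (intro equalityI subsetI)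
  fix z assume "z \<in> (\<lambda>x. r *\<^sub>R x) ` (x +o F) + F"
  then obtain f g where fg: "f \<in> F" "g \<in> F" "z = r *\<^sub>R (x + f) + g"
    by (auto simp: set_plus_def elt_set_plus_def)
  have "r *\<^sub>R f + g \<in> F"
    using F fg by (simp add: Real_Vector_Spaces.subspace_def)
  moreover have "z = r *\<^sub>R x + (r *\<^sub>R f + g)"
    by (simp add: fg(3) scaleR_add_right add.assoc)
  ultimately show "z \<in> (r *\<^sub>R x) +o F"
    by (simp only: set_plus_intro2)
next
  fix z assume "z \<in> (r *\<^sub>R x) +o F"
  then obtain g where g: "g \<in> F" "z = r *\<^sub>R (x + 0) + g"
    by (auto simp: elt_set_plus_def)
  have "0 \<in> F" using F by (simp add: Real_Vector_Spaces.subspace_def)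
  then have "x + 0 \<in> x +o F" by (rule set_plus_intro2)
  then show "z \<in> (\<lambda>x. r *\<^sub>R x) ` (x +o F) + F"
    unfolding g(2) using g(1) by (intro set_plus_intro imageI)
qed

lemma vectorspace_quotient_space:
  assumes F: "Real_Vector_Spaces.subspace F"
  shows "vectorspace (class_ring :: real ring) (quotient_space F)"
proof -
  note coset_simps = coset_add[OF F] coset_scaleR[OF F]
  let ?Q = "quotient_space F"
  have Q [simp]: "carrier ?Q = range (\<lambda>x. x +o F)" "\<zero>\<^bsub>?Q\<^esub> = 0 +o F"
      "add ?Q = (+)" "smult ?Q = (\<lambda>r C. (\<lambda>x. r *\<^sub>R x) ` C + F)"
    by (auto simp: quotient_space_def)
  have K: "add class_ring = ((+) :: real \<Rightarrow> _)" "monoid.mult class_ring = ((*) :: real \<Rightarrow> _)"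
      "\<one>\<^bsub>class_ring\<^esub> = (1 :: real)"
    by simp_all
  have "abelian_group ?Q"
  proof (rule abelian_groupI)
    fix C D assume "C \<in> carrier ?Q" "D \<in> carrier ?Q"
    then obtain x y where "C = x +o F" "D = y +o F" by auto
    then show "C \<oplus>\<^bsub>?Q\<^esub> D \<in> carrier ?Q"
      by (simp only: Q coset_simps) blast
  next
    show "\<zero>\<^bsub>?Q\<^esub> \<in> carrier ?Q"
      by (simp only: Q) blast
  next
    fix C D E
    show "(C \<oplus>\<^bsub>?Q\<^esub> D) \<oplus>\<^bsub>?Q\<^esub> E = C \<oplus>\<^bsub>?Q\<^esub> (D \<oplus>\<^bsub>?Q\<^esub> E)"
      by (simp only: Q add.assoc)
  next
    fix C D
    show "C \<oplus>\<^bsub>?Q\<^esub> D = D \<oplus>\<^bsub>?Q\<^esub> C"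
      by (simp only: Q add.commute)
  next
    fix C assume "C \<in> carrier ?Q"
    then obtain x where "C = x +o F" by auto
    then show "\<zero>\<^bsub>?Q\<^esub> \<oplus>\<^bsub>?Q\<^esub> C = C"
      by (simp only: Q coset_simps add_0_left)
  next
    fix C assume "C \<in> carrier ?Q"
    then obtain x where "C = x +o F" by auto
    then have "((- x) +o F) \<oplus>\<^bsub>?Q\<^esub> C = \<zero>\<^bsub>?Q\<^esub>"
      by (simp only: Q coset_simps left_minus)
    moreover have "(- x) +o F \<in> carrier ?Q"
      by (simp only: Q) blast
    ultimately show "\<exists>D\<in>carrier ?Q. D \<oplus>\<^bsub>?Q\<^esub> C = \<zero>\<^bsub>?Q\<^esub>"
      by blast
  qed
  moreover have "module (class_ring :: real ring) ?Q"
  proof (intro moduleI \<open>abelian_group ?Q\<close> class_cring.is_cring)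
    fix a b :: real and C assume "C \<in> carrier ?Q"
    then obtain x where "C = x +o F" by auto
    then show "(a \<oplus>\<^bsub>class_ring\<^esub> b) \<odot>\<^bsub>?Q\<^esub> C = a \<odot>\<^bsub>?Q\<^esub> C \<oplus>\<^bsub>?Q\<^esub> b \<odot>\<^bsub>?Q\<^esub> C"
      by (simp only: Q K coset_simps scaleR_add_left)
  next
    fix a b :: real and C assume "C \<in> carrier ?Q"
    then obtain x where "C = x +o F" by auto
    then show "(a \<otimes>\<^bsub>class_ring\<^esub> b) \<odot>\<^bsub>?Q\<^esub> C = a \<odot>\<^bsub>?Q\<^esub> (b \<odot>\<^bsub>?Q\<^esub> C)"
      by (simp only: Q K coset_simps scaleR_scaleR)
  next
    fix a :: real and C D assume "C \<in> carrier ?Q" "D \<in> carrier ?Q"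
    then obtain x y where "C = x +o F" "D = y +o F" by auto
    then show "a \<odot>\<^bsub>?Q\<^esub> (C \<oplus>\<^bsub>?Q\<^esub> D) = a \<odot>\<^bsub>?Q\<^esub> C \<oplus>\<^bsub>?Q\<^esub> a \<odot>\<^bsub>?Q\<^esub> D"
      by (simp only: Q coset_simps scaleR_add_right)
  next
    fix C assume "C \<in> carrier ?Q"
    then obtain x where "C = x +o F" by auto
    then show "\<one>\<^bsub>class_ring\<^esub> \<odot>\<^bsub>?Q\<^esub> C = C"
      by (simp only: Q K coset_simps scaleR_one)
  next
    fix a :: real and C assume "C \<in> carrier ?Q"
    then obtain x where "C = x +o F" by auto
    then show "a \<odot>\<^bsub>?Q\<^esub> C \<in> carrier ?Q"
      by (simp only: Q coset_simps) blast
  qed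
  ultimately show ?thesis
    by (simp add: vectorspace_def class_field.field_axioms)
qed

definition has_codimension :: "'a::real_vector set \<Rightarrow> nat \<Rightarrow> bool" where
  "has_codimension F n \<longleftrightarrow>
     Real_Vector_Spaces.subspace F \<and>
     vectorspace.fin_dim (class_ring :: real ring) (quotient_space F) \<and>
     vectorspace.dim (class_ring :: real ring) (quotient_space F) = n"

end

theory Submission
  imports Defs
begin

text \<open>
  Write \<open>x\<^sup>+\<close> for the positive part \<open>pprt x\<close>. An ideal \<open>J\<close> is uniformly closed as soon as
  \<open>u \<in> J\<close> whenever \<open>u, e \<ge> 0\<close> and all truncations \<open>(u - c e)\<^sup>+\<close> with \<open>c > 0\<close> lie in \<open>J\<close>
  (lemma \<open>uniformly_closed_if_pprt\<close>): if \<open>y \<in> J\<close> and \<open>\<bar>x - y\<bar> \<le> c e\<close>, then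
  \<open>(\<bar>x\<bar> - c e)\<^sup>+ \<le> \<bar>y\<bar>\<close>.

  Suppose that \<open>u\<close> is such an element. The idea is that \<open>u\<close> is dominated modulo \<open>J\<close> by an
  element \<open>v\<close> of the same kind that is infinitely larger (lemma \<open>exists_dominating\<close>). Think of
  \<open>u\<close> as a nonnegative function and of \<open>e\<close> as the constant \<open>1\<close>; then \<open>v = f \<circ> u\<close> for a
  continuous \<open>f\<close> with \<open>f 0 = 0\<close> and infinite slope at \<open>0\<close>. Concretely, take
  \<open>v = (\<Sum>k. inf u (2\<^sup>-\<^sup>k e))\<close>, which exists by uniform completeness. Each summand equals \<open>u\<close>
  modulo \<open>J\<close>, because \<open>u - inf u (2\<^sup>-\<^sup>k e) = (u - 2\<^sup>-\<^sup>k e)\<^sup>+\<close>, so for every \<open>n\<close> there is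
  \<open>j \<in> J\<close> with \<open>n u \<le> v + j\<close>. Moreover \<open>v \<le> N u + c e\<close> for arbitrarily small \<open>c\<close> and suitable
  \<open>N\<close>, so the truncations of \<open>v\<close> lie in \<open>J\<close> as well.

  Finite codimension excludes an infinite tower of such elements. The proof is by induction on the
  size of a finite set that spans the space together with \<open>J\<close> (lemma
  \<open>mem_if_truncations_mem\<close>). If \<open>u \<notin> J\<close>, then the ideal \<open>J'\<close> generated by \<open>J\<close> and \<open>u\<close>
  needs fewer vectors, so by induction \<open>v \<in> J'\<close>, that is, \<open>v \<le> i + c u\<close> with \<open>i \<in> J\<close>. Together
  with \<open>n u \<le> v + j\<close> for some \<open>n \<ge> c + 1\<close> this gives \<open>u \<le> i + j\<close>, hence \<open>u \<in> J\<close>,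
  a contradiction.
\<close>


section \<open>Order ideals and the order-unit seminorm\<close>

lemma abs_scaleR_le:
  fixes x :: "'a::vector_lattice"
  shows "\<bar>r *\<^sub>R x\<bar> \<le> \<bar>r\<bar> *\<^sub>R \<bar>x\<bar>"
proof (rule abs_leI)
  have pm: "x \<le> \<bar>x\<bar>" "- x \<le> \<bar>x\<bar>"
    by (auto simp: abs_ge_self abs_ge_minus_self)
  show "r *\<^sub>R x \<le> \<bar>r\<bar> *\<^sub>R \<bar>x\<bar>"
    using scaleR_left_mono[OF pm(1), of r] scaleR_left_mono[OF pm(2), of "- r"]
    by (cases "0 \<le> r") auto
  show "- (r *\<^sub>R x) \<le> \<bar>r\<bar> *\<^sub>R \<bar>x\<bar>"
    using scaleR_left_mono[OF pm(2), of r] scaleR_left_mono[OF pm(1), of "- r"]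
    by (cases "0 \<le> r") auto
qed

lemma order_ideal_subspace: "order_ideal J \<Longrightarrow> Real_Vector_Spaces.subspace J"
  by (simp add: order_ideal_def)

lemma order_idealD:
  fixes x y :: "'a::vector_lattice"
  shows "order_ideal J \<Longrightarrow> \<bar>x\<bar> \<le> \<bar>y\<bar> \<Longrightarrow> y \<in> J \<Longrightarrow> x \<in> J"
  unfolding order_ideal_def by blast

lemma order_ideal_between:
  fixes x y :: "'a::vector_lattice"
  assumes "order_ideal J" "0 \<le> x" "x \<le> y" "y \<in> J"
  shows "x \<in> J"
proof -
  have "0 \<le> y" using assms by (meson order_trans)
  then have "\<bar>x\<bar> \<le> \<bar>y\<bar>" using assms by simp
  then show ?thesis using assms order_idealD by blast
qed

lemma order_ideal_abs_iff:
  fixes x :: "'a::vector_lattice"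
  assumes "order_ideal J"
  shows "\<bar>x\<bar> \<in> J \<longleftrightarrow> x \<in> J"
  using order_idealD[OF assms, of x "\<bar>x\<bar>"] order_idealD[OF assms, of "\<bar>x\<bar>" x] by auto

lemma pprt_leI:
  fixes x :: "'a::lattice_ab_group_add"
  shows "x \<le> y \<Longrightarrow> 0 \<le> y \<Longrightarrow> pprt x \<le> y"
  by (simp add: pprt_def)

lemma order_norm_le:
  fixes x :: "'a::vector_lattice"
  assumes "0 < c" "\<bar>x\<bar> \<le> c *\<^sub>R e"
  shows "order_norm e x \<le> c"
  unfolding order_norm_def
  using assms by (intro cInf_lower) (auto intro!: bdd_belowI[of _ 0])

lemma abs_le_of_order_norm_less:
  fixes x :: "'a::vector_lattice"
  assumes e: "0 \<le> e" and x: "x \<in> principal_ideal e" and less: "order_norm e x < c"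
  shows "\<bar>x\<bar> \<le> c *\<^sub>R e"
proof -
  have "{c. 0 < c \<and> \<bar>x\<bar> \<le> c *\<^sub>R e} \<noteq> {}"
    using x principal_ideal_iff[OF e] by blast
  then obtain d where "\<bar>x\<bar> \<le> d *\<^sub>R e" "d < c"
    using cInf_lessD[OF _ less[unfolded order_norm_def]] by blast
  moreover have "d *\<^sub>R e \<le> c *\<^sub>R e"
    using \<open>d < c\<close> e by (intro scaleR_right_mono) auto
  ultimately show ?thesis by (meson order_trans)
qed

lemma archimedean_le:
  fixes x y e :: "'a::archimedean_vector_lattice"
  assumes e: "0 \<le> e" and le: "\<And>c. 0 < c \<Longrightarrow> x \<le> y + c *\<^sub>R e"
  shows "x \<le> y"
proof -
  have "x - y \<le> 0"
  proof (rule archimedean)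
    fix n :: nat
    show "real n *\<^sub>R (x - y) \<le> e"
    proof (cases "n = 0")
      case True
      then show ?thesis using e by simp
    next
      case False
      then have "x - y \<le> inverse (real n) *\<^sub>R e"
        using le[of "inverse (real n)"] by (simp add: algebra_simps)
      then have "real n *\<^sub>R (x - y) \<le> real n *\<^sub>R (inverse (real n) *\<^sub>R e)"
        by (rule scaleR_left_mono) simp
      then show ?thesis using False by simp
    qed
  qed
  then show ?thesis by simp
qed

section \<open>A truncation criterion for uniform closedness\<close>

lemma uniformly_closed_if_pprt:
  fixes J :: "'a::vector_lattice set"
  assumes J: "order_ideal J"
    and trunc: "\<And>u e. 0 \<le> u \<Longrightarrow> 0 \<le> e \<Longrightarrow> (\<And>c. 0 < c \<Longrightarrow> pprt (u - c *\<^sub>R e) \<in> J) \<Longrightarrow> u \<in> J"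
  shows "uniformly_closed J"
  unfolding uniformly_closed_def
proof (intro allI impI, elim conjE)
  fix F :: "'a filter" and x
  assume F: "F \<noteq> bot" and yJ: "\<forall>\<^sub>F y in F. y \<in> J" and "uniformly_tendsto (\<lambda>y. y) x F"
  then obtain e where e: "0 \<le> e" and mem: "\<forall>\<^sub>F y in F. y - x \<in> principal_ideal e"
    and lim: "((\<lambda>y. order_norm e (y - x)) \<longlongrightarrow> 0) F"
    unfolding uniformly_tendsto_def by blast
  have "\<bar>x\<bar> \<in> J"
  proof (rule trunc[OF _ e])
    fix c :: real assume "0 < c"
    then have "\<forall>\<^sub>F y in F. order_norm e (y - x) < c"
      using lim by (rule order_tendstoD(2)[rotated])
    with yJ mem have "\<forall>\<^sub>F y in F. y \<in> J \<and> y - x \<in> principal_ideal e \<and> order_norm e (y - x) < c"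
      by (simp add: eventually_conj_iff)
    then obtain y where y: "y \<in> J" "y - x \<in> principal_ideal e" "order_norm e (y - x) < c"
      using F eventually_happens by blast
    have "\<bar>x\<bar> \<le> \<bar>y\<bar> + \<bar>y - x\<bar>"
      using abs_triangle_ineq[of y "x - y"] by (simp add: abs_minus_commute)
    also have "\<dots> \<le> \<bar>y\<bar> + c *\<^sub>R e"
      using abs_le_of_order_norm_less[OF e y(2,3)] by (rule add_left_mono)
    finally have "pprt (\<bar>x\<bar> - c *\<^sub>R e) \<le> \<bar>y\<bar>"
      by (intro pprt_leI) (simp_all add: diff_le_eq)
    then show "pprt (\<bar>x\<bar> - c *\<^sub>R e) \<in> J"
      using J y(1) order_ideal_between[OF J zero_le_pprt] order_ideal_abs_iff[OF J] by blast
  qed simp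
  then show "x \<in> J" by (simp add: order_ideal_abs_iff[OF J])
qed

section \<open>Adjoining an element to an ideal\<close>

text \<open>For an ideal \<open>J\<close> and \<open>u \<ge> 0\<close> this is the ideal generated by \<open>J\<close> and \<open>u\<close>. The scalar \<open>c\<close>
  may have any sign; for \<open>u \<ge> 0\<close> enlarging it to \<open>\<bar>c\<bar>\<close> only weakens the bound.\<close>

definition ideal_adjoin :: "'a::vector_lattice set \<Rightarrow> 'a \<Rightarrow> 'a set" where
  "ideal_adjoin J u = {x. \<exists>j\<in>J. \<exists>c. \<bar>x\<bar> \<le> j + c *\<^sub>R u}"

lemma order_ideal_adjoin:
  assumes J: "order_ideal J"
  shows "order_ideal (ideal_adjoin J u)"
proof -
  note sub = order_ideal_subspace[OF J]
  have "Real_Vector_Spaces.subspace (ideal_adjoin J u)"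
    unfolding Real_Vector_Spaces.subspace_def
  proof (intro conjI ballI allI)
    show "0 \<in> ideal_adjoin J u"
      using Real_Vector_Spaces.subspace_0[OF sub]
      by (auto simp: ideal_adjoin_def intro!: bexI[of _ 0] exI[of _ 0])
  next
    fix x y assume "x \<in> ideal_adjoin J u" "y \<in> ideal_adjoin J u"
    then obtain i j c d where ij: "i \<in> J" "\<bar>x\<bar> \<le> i + c *\<^sub>R u" "j \<in> J" "\<bar>y\<bar> \<le> j + d *\<^sub>R u"
      unfolding ideal_adjoin_def by blast
    have "\<bar>x + y\<bar> \<le> \<bar>x\<bar> + \<bar>y\<bar>" by (rule abs_triangle_ineq)
    also have "\<dots> \<le> (i + c *\<^sub>R u) + (j + d *\<^sub>R u)" using ij by (intro add_mono)
    also have "\<dots> = (i + j) + (c + d) *\<^sub>R u" by (simp add: scaleR_add_left)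
    finally show "x + y \<in> ideal_adjoin J u"
      using Real_Vector_Spaces.subspace_add[OF sub ij(1,3)] unfolding ideal_adjoin_def by blast
  next
    fix r :: real and x assume "x \<in> ideal_adjoin J u"
    then obtain j c where j: "j \<in> J" "\<bar>x\<bar> \<le> j + c *\<^sub>R u"
      unfolding ideal_adjoin_def by blast
    have "\<bar>r *\<^sub>R x\<bar> \<le> \<bar>r\<bar> *\<^sub>R \<bar>x\<bar>" by (rule abs_scaleR_le)
    also have "\<dots> \<le> \<bar>r\<bar> *\<^sub>R (j + c *\<^sub>R u)" using j by (intro scaleR_left_mono) auto
    also have "\<dots> = \<bar>r\<bar> *\<^sub>R j + (\<bar>r\<bar> * c) *\<^sub>R u" by (simp add: scaleR_add_right)
    finally show "r *\<^sub>R x \<in> ideal_adjoin J u"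
      using Real_Vector_Spaces.subspace_scale[OF sub j(1)] unfolding ideal_adjoin_def by blast
  qed
  then show ?thesis
    unfolding order_ideal_def ideal_adjoin_def by (blast intro: order_trans)
qed

lemma subset_ideal_adjoin:
  assumes J: "order_ideal J"
  shows "J \<subseteq> ideal_adjoin J u"
proof
  fix x assume "x \<in> J"
  then have "\<bar>x\<bar> \<in> J" by (simp add: order_ideal_abs_iff[OF J])
  then show "x \<in> ideal_adjoin J u"
    by (auto simp: ideal_adjoin_def intro!: bexI[of _ "\<bar>x\<bar>"] exI[of _ 0])
qed

lemma mem_ideal_adjoin:
  assumes "order_ideal J" "0 \<le> u"
  shows "u \<in> ideal_adjoin J u"
  using assms Real_Vector_Spaces.subspace_0[OF order_ideal_subspace[OF assms(1)]]
  by (auto simp: ideal_adjoin_def intro!: bexI[of _ 0] exI[of _ 1])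

section \<open>An infinitely larger element with the same truncation property\<close>

text \<open>The last conclusion says that, modulo \<open>J\<close>, \<open>u\<close> is infinitesimal with respect to \<open>v\<close>.\<close>

lemma exists_dominating:
  fixes u e :: "'a::archimedean_vector_lattice"
  assumes uc: "uniformly_complete TYPE('a)" and J: "order_ideal J"
    and u: "0 \<le> u" and e: "0 \<le> e"
    and trunc: "\<And>c. 0 < c \<Longrightarrow> pprt (u - c *\<^sub>R e) \<in> J"
  obtains v where "0 \<le> v" "\<And>c. 0 < c \<Longrightarrow> pprt (v - c *\<^sub>R e) \<in> J"
    "\<And>n. \<exists>j\<in>J. real n *\<^sub>R u \<le> v + j"
proof -
  note sub = order_ideal_subspace[OF J]
  define t where "t k = inf u ((1/2)^k *\<^sub>R e)" for k :: nat
  define s where "s n = (\<Sum>k<n. t k)" for n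
  have t_nonneg: "0 \<le> t k" for k
    using u e by (simp add: t_def scaleR_nonneg_nonneg)
  have t_le_u: "t k \<le> u" and t_le_e: "t k \<le> (1/2)^k *\<^sub>R e" for k
    by (simp_all add: t_def)
  have t_eq: "t k = u - pprt (u - (1/2)^k *\<^sub>R e)" for k
  proof -
    have "u - pprt (u - (1/2)^k *\<^sub>R e) = u + inf (- (u - (1/2)^k *\<^sub>R e)) (- 0)"
      by (simp only: pprt_def diff_conv_add_uminus neg_sup_eq_inf)
    also have "\<dots> = inf ((1/2)^k *\<^sub>R e) u"
      by (simp add: add_inf_distrib_left)
    finally show ?thesis by (simp add: t_def inf_commute)
  qed
  have tail: "s (n + d) - s n \<le> (2 * (1/2)^n) *\<^sub>R e - (2 * (1/2)^(n+d)) *\<^sub>R e" for n d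
  proof (induction d)
    case (Suc d)
    have "s (n + Suc d) - s n = (s (n + d) - s n) + t (n + d)" by (simp add: s_def)
    also have "\<dots> \<le> ((2 * (1/2)^n) *\<^sub>R e - (2 * (1/2)^(n+d)) *\<^sub>R e) + (1/2)^(n+d) *\<^sub>R e"
      by (intro add_mono Suc.IH t_le_e)
    also have "\<dots> = (2 * (1/2)^n) *\<^sub>R e - (2 * (1/2)^(n+Suc d)) *\<^sub>R e"
      by (simp add: algebra_simps flip: scaleR_add_left scaleR_diff_left)
    finally show ?case .
  qed simp
  have tail': "s m - s n \<le> (2 * (1/2)^n) *\<^sub>R e" if "n \<le> m" for m n
  proof -
    have "s m - s n \<le> (2 * (1/2)^n) *\<^sub>R e - (2 * (1/2)^m) *\<^sub>R e"
      using tail[of n "m - n"] that by simp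
    also have "\<dots> \<le> (2 * (1/2)^n) *\<^sub>R e" using e by (simp add: scaleR_nonneg_nonneg)
    finally show ?thesis .
  qed
  have s_mono: "s n \<le> s m" if "n \<le> m" for m n
    unfolding s_def using that t_nonneg by (intro sum_mono2) auto
  have s_abs: "\<bar>s m - s n\<bar> \<le> (2 * (1/2)^(min m n)) *\<^sub>R e" for m n
    using tail'[of n m] tail'[of m n] s_mono[of n m] s_mono[of m n]
    by (cases "n \<le> m") (auto simp: min_def abs_minus_commute[of "s m"])
  have s_pi: "s n \<in> principal_ideal e" for n
    using s_abs[of n 0] by (auto simp: principal_ideal_iff[OF e] s_def intro!: exI[of _ 2])
  have cauchy: "\<exists>N. \<forall>m\<ge>N. \<forall>n\<ge>N. order_norm e (s m - s n) < c" if "0 < c" for c :: real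
  proof -
    obtain N where N: "(1/2)^N < c / 2"
      using real_arch_pow_inv[of "c/2" "1/2"] \<open>0 < c\<close> by auto
    show ?thesis
    proof (intro exI allI impI)
      fix m n assume "N \<le> m" "N \<le> n"
      have "order_norm e (s m - s n) \<le> 2 * (1/2)^(min m n)"
        by (rule order_norm_le[OF _ s_abs]) simp
      also have "\<dots> \<le> 2 * (1/2)^N"
        using \<open>N \<le> m\<close> \<open>N \<le> n\<close> by (intro mult_left_mono power_decreasing) auto
      also have "\<dots> < c" using N by simp
      finally show "order_norm e (s m - s n) < c" .
    qed
  qed
  obtain v where v: "v \<in> principal_ideal e" and lim: "(\<lambda>n. order_norm e (s n - v)) \<longlonglongrightarrow> 0"
    using uc e s_pi cauchy unfolding uniformly_complete_def by blast
  have diff: "s n - v \<in> principal_ideal e" for n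
    using s_pi[of n] v unfolding principal_ideal_def hull_def
    by (auto intro!: Real_Vector_Spaces.subspace_diff order_ideal_subspace)
  have close: "\<exists>N. \<forall>n\<ge>N. \<bar>s n - v\<bar> \<le> c *\<^sub>R e" if "0 < c" for c
    using order_tendstoD(2)[OF lim that] abs_le_of_order_norm_less[OF e diff]
    unfolding eventually_sequentially by blast
  \<comment> \<open>Norm convergence only gives \<open>s n \<le> v + c e\<close> for all \<open>c > 0\<close>; the Archimedean property
      removes the error term.\<close>
  have s_le_v: "s n \<le> v" for n
  proof (rule archimedean_le[OF e])
    fix c :: real assume "0 < c"
    then obtain N where N: "\<bar>s m - v\<bar> \<le> c *\<^sub>R e" if "m \<ge> N" for m using close by blast
    have "s n \<le> s (max n N)" by (simp add: s_mono)
    also have "\<dots> \<le> v + c *\<^sub>R e"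
      using N[of "max n N"] by (simp add: abs_le_iff algebra_simps)
    finally show "s n \<le> v + c *\<^sub>R e" .
  qed
  show ?thesis
  proof
    show "0 \<le> v" using s_le_v[of 0] by (simp add: s_def)
  next
    fix c :: real assume c: "0 < c"
    then obtain N0 where N0: "\<bar>s n - v\<bar> \<le> (c/2) *\<^sub>R e" if "n \<ge> N0" for n
      using close[of "c/2"] by auto
    \<comment> \<open>The index is made positive because the truncation level of \<open>u\<close> is divided by it.\<close>
    define N where "N = Suc N0"
    have N: "0 < real N" "\<bar>s N - v\<bar> \<le> (c/2) *\<^sub>R e" using N0 by (auto simp: N_def)
    have "s N \<le> real N *\<^sub>R u"
      using sum_mono[of "{..<N}" t "\<lambda>_. u"] t_le_u by (simp add: s_def sum_constant_scaleR)
    moreover have "v - s N \<le> (c/2) *\<^sub>R e" using N(2) by (simp add: abs_le_iff)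
    ultimately have "s N + (v - s N) \<le> real N *\<^sub>R u + (c/2) *\<^sub>R e"
      by (rule add_mono)
    then have "v - c *\<^sub>R e \<le> real N *\<^sub>R u + (c/2) *\<^sub>R e - c *\<^sub>R e"
      by (simp add: diff_right_mono)
    also have "\<dots> = real N *\<^sub>R (u - (c / 2 / real N) *\<^sub>R e)"
      using N(1) by (simp add: scaleR_diff_right flip: scaleR_diff_left add_diff_eq)
    also have "\<dots> \<le> real N *\<^sub>R pprt (u - (c / 2 / real N) *\<^sub>R e)"
      using N(1) by (intro scaleR_left_mono) (auto simp: pprt_def)
    finally have "pprt (v - c *\<^sub>R e) \<le> real N *\<^sub>R pprt (u - (c / 2 / real N) *\<^sub>R e)"
      by (intro pprt_leI scaleR_nonneg_nonneg) auto
    moreover have "real N *\<^sub>R pprt (u - (c / 2 / real N) *\<^sub>R e) \<in> J"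
      using trunc c N(1) by (intro Real_Vector_Spaces.subspace_scale[OF sub]) simp
    ultimately show "pprt (v - c *\<^sub>R e) \<in> J"
      by (rule order_ideal_between[OF J zero_le_pprt])
  next
    fix n :: nat
    define j where "j = (\<Sum>k<n. pprt (u - (1/2)^k *\<^sub>R e))"
    have "j \<in> J"
      unfolding j_def using trunc by (intro Real_Vector_Spaces.subspace_sum[OF sub]) simp
    moreover have "real n *\<^sub>R u = s n + j"
      by (simp add: s_def j_def t_eq sum_subtractf sum_constant_scaleR)
    ultimately show "\<exists>j\<in>J. real n *\<^sub>R u \<le> v + j"
      using s_le_v[of n] by (metis add_right_mono)
  qed
qed

section \<open>Induction on the codimension\<close>

text \<open>Adjoining to \<open>S\<close> a vector \<open>u\<close> outside its span makes some vector of a finite complement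
  \<open>B\<close> superfluous.\<close>

lemma span_exchange_finite:
  fixes S B :: "'a::real_vector set"
  assumes "finite B" "u \<in> Real_Vector_Spaces.span (S \<union> B)" "u \<notin> Real_Vector_Spaces.span S"
  shows "\<exists>b\<in>B. b \<in> Real_Vector_Spaces.span (insert u (S \<union> (B - {b})))"
  using assms
proof (induction B rule: finite_induct)
  case (insert b B)
  show ?case
  proof (cases "u \<in> Real_Vector_Spaces.span (S \<union> B)")
    case True
    then obtain b' where b': "b' \<in> B"
      "b' \<in> Real_Vector_Spaces.span (insert u (S \<union> (B - {b'})))"
      using insert by blast
    have "insert u (S \<union> (B - {b'})) \<subseteq> insert u (S \<union> (insert b B - {b'}))" by blast
    then show ?thesis
      using b' Real_Vector_Spaces.span_mono by blast
  next
    case False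
    have "u \<in> Real_Vector_Spaces.span (insert b (S \<union> B))"
      using insert.prems(1) by simp
    then have "b \<in> Real_Vector_Spaces.span (insert u (S \<union> B))"
      using False by (rule Real_Vector_Spaces.in_span_insert)
    moreover have "insert b B - {b} = B" using insert.hyps by simp
    ultimately show ?thesis by auto
  qed
qed simp

text \<open>The finite set \<open>B\<close> witnesses that \<open>J\<close> has finite codimension. The unit \<open>e\<close> stays fixed in
  the induction, while \<open>J\<close> and \<open>u\<close> vary: the induction hypothesis is applied to the larger ideal
  generated by \<open>J\<close> and \<open>u\<close> and to the element of \<open>exists_dominating\<close>.\<close>

lemma mem_if_truncations_mem:
  fixes J :: "'a::archimedean_vector_lattice set"
  assumes uc: "uniformly_complete TYPE('a)" and e: "0 \<le> e"
    and "finite B" "order_ideal J" "Real_Vector_Spaces.span (J \<union> B) = UNIV"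
    and "0 \<le> u" "\<And>c. 0 < c \<Longrightarrow> pprt (u - c *\<^sub>R e) \<in> J"
  shows "u \<in> J"
  using assms(3-)
proof (induction "card B" arbitrary: B J u rule: less_induct)
  case less
  note fin = less.prems(1) and J = less.prems(2) and span = less.prems(3)
    and u = less.prems(4) and trunc = less.prems(5)
  note sub = order_ideal_subspace[OF J]
  show ?case
  proof (rule ccontr)
    assume "u \<notin> J"
    then have "u \<notin> Real_Vector_Spaces.span J"
      by (simp only: Real_Vector_Spaces.span_eq_iff[THEN iffD2, OF sub] not_False_eq_True)
    then obtain b where b: "b \<in> B" "b \<in> Real_Vector_Spaces.span (insert u (J \<union> (B - {b})))"
      using span_exchange_finite[OF fin, of u J] span by auto
    define J' where "J' = ideal_adjoin J u"
    have J': "order_ideal J'" "J \<subseteq> J'" "u \<in> J'"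
      using J u by (simp_all add: J'_def order_ideal_adjoin subset_ideal_adjoin mem_ideal_adjoin)
    have "insert u (J \<union> (B - {b})) \<subseteq> J' \<union> (B - {b})" using J' by blast
    then have "b \<in> Real_Vector_Spaces.span (J' \<union> (B - {b}))"
      using b(2) Real_Vector_Spaces.span_mono by blast
    moreover have "J \<union> (B - {b}) \<subseteq> J' \<union> (B - {b})" using J' by blast
    ultimately have "J \<union> B \<subseteq> Real_Vector_Spaces.span (J' \<union> (B - {b}))"
      using Real_Vector_Spaces.span_superset[of "J' \<union> (B - {b})"] by blast
    then have span': "Real_Vector_Spaces.span (J' \<union> (B - {b})) = UNIV"
      using Real_Vector_Spaces.span_minimal[OF _ Real_Vector_Spaces.subspace_span] span by blast
    obtain v where v: "0 \<le> v" "\<And>c. 0 < c \<Longrightarrow> pprt (v - c *\<^sub>R e) \<in> J"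
      and dom: "\<And>n. \<exists>j\<in>J. real n *\<^sub>R u \<le> v + j"
      using exists_dominating[OF uc J u e trunc] by blast
    have "v \<in> J'"
    proof (rule less.hyps[OF _ _ J'(1) span' v(1)])
      show "card (B - {b}) < card B" using fin b(1) by (rule card_Diff1_less)
      show "pprt (v - c *\<^sub>R e) \<in> J'" if "0 < c" for c using v(2)[OF that] J'(2) by blast
    qed (use fin in simp)
    then obtain i c where i: "i \<in> J" "\<bar>v\<bar> \<le> i + c *\<^sub>R u"
      unfolding J'_def ideal_adjoin_def by blast
    obtain n where n: "c + 1 \<le> real n" using real_arch_simple by blast
    obtain j where j: "j \<in> J" "real n *\<^sub>R u \<le> v + j" using dom by blast
    have "(c + 1) *\<^sub>R u \<le> real n *\<^sub>R u" using n u by (rule scaleR_right_mono)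
    also have "\<dots> \<le> v + j" by (rule j)
    also have "\<dots> \<le> i + c *\<^sub>R u + j"
      using i(2) abs_ge_self[of v] by (intro add_right_mono) (rule order_trans)
    finally have "u \<le> i + j" by (simp add: scaleR_add_left algebra_simps)
    then have "u \<in> J"
      using order_ideal_between[OF J u] Real_Vector_Spaces.subspace_add[OF sub i(1) j(1)] by blast
    with \<open>u \<notin> J\<close> show False by contradiction
  qed
qed

section \<open>Finite complements of subspaces of finite codimension\<close>

lemma finite_complement_if_codimension:
  fixes F :: "'a::real_vector set"
  assumes "has_codimension F n"
  obtains B where "finite B" "Real_Vector_Spaces.span (F \<union> B) = UNIV"
proof -
  let ?K = "class_ring :: real ring" and ?Q = "quotient_space F"
  have F: "Real_Vector_Spaces.subspace F" and fd: "vectorspace.fin_dim ?K ?Q"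
    using assms by (auto simp: has_codimension_def)
  interpret Q: vectorspace ?K ?Q using F by (rule vectorspace_quotient_space)
  obtain A where A: "finite A" "A \<subseteq> carrier ?Q" "Q.gen_set A"
    using fd unfolding Q.fin_dim_def by blast
  then obtain B where B: "finite B" "A = (\<lambda>x. x +o F) ` B"
    unfolding quotient_space_def by (auto dest: finite_subset_image)
  define S where "S = Real_Vector_Spaces.span (F \<union> B)"
  have S: "Real_Vector_Spaces.subspace S" by (simp add: S_def Real_Vector_Spaces.subspace_span)
  have FB: "F \<union> B \<subseteq> S" unfolding S_def by (rule Real_Vector_Spaces.span_superset)
  \<comment> \<open>The cosets of the elements of \<open>S\<close> form a submodule containing the generators \<open>A\<close>.\<close>
  have "submodule ?K ((\<lambda>x. x +o F) ` S) ?Q"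
  proof
    show "(\<lambda>x. x +o F) ` S \<subseteq> carrier ?Q" by (auto simp: quotient_space_def)
  next
    fix C D assume "C \<in> (\<lambda>x. x +o F) ` S" "D \<in> (\<lambda>x. x +o F) ` S"
    then show "C \<oplus>\<^bsub>?Q\<^esub> D \<in> (\<lambda>x. x +o F) ` S"
      using Real_Vector_Spaces.subspace_add[OF S] by (auto simp: quotient_space_def coset_add[OF F])
  next
    have "0 +o F \<in> (\<lambda>x. x +o F) ` S" using Real_Vector_Spaces.subspace_0[OF S] by (rule imageI)
    then show "\<zero>\<^bsub>?Q\<^esub> \<in> (\<lambda>x. x +o F) ` S" by (simp add: quotient_space_def)
  next
    fix r :: real and C assume "C \<in> (\<lambda>x. x +o F) ` S"
    then show "r \<odot>\<^bsub>?Q\<^esub> C \<in> (\<lambda>x. x +o F) ` S"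
      using Real_Vector_Spaces.subspace_scale[OF S] by (auto simp: quotient_space_def coset_scaleR[OF F])
  qed
  moreover have "A \<subseteq> (\<lambda>x. x +o F) ` S" using B FB by blast
  ultimately have "carrier ?Q \<subseteq> (\<lambda>x. x +o F) ` S"
    using Q.span_is_subset A(3) by blast
  have "x \<in> S" for x
  proof -
    obtain y where y: "y \<in> S" "x +o F = y +o F"
      using \<open>carrier ?Q \<subseteq> _\<close> by (auto simp: quotient_space_def)
    have "x + 0 \<in> x +o F"
      using Real_Vector_Spaces.subspace_0[OF F] by (rule set_plus_intro2)
    then have "x \<in> y +o F" by (simp add: y(2))
    then obtain f where "f \<in> F" "x = y + f" unfolding elt_set_plus_def by blast
    then show "x \<in> S" using Real_Vector_Spaces.subspace_add[OF S y(1)] FB by blast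
  qed
  then show thesis using that B(1) unfolding S_def by blast
qed

theorem proposition6p2:
  fixes J :: "'a::archimedean_vector_lattice set"
  assumes "uniformly_complete TYPE('a)"
    and "order_ideal J"
    and "\<exists>n. has_codimension J n"
  shows "uniformly_closed J"
proof -
  obtain B where "finite B" "Real_Vector_Spaces.span (J \<union> B) = UNIV"
    using assms(3) finite_complement_if_codimension by blast
  then show ?thesis
    using assms(1,2) mem_if_truncations_mem
    by (intro uniformly_closed_if_pprt) blast+
qed

end
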